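(* Let $ABC$ be a triangle with centroid $M$ and medians $AD$, $BE$, $CF$, where $D$ is on $BC$, $E$ on $CA$, $F$ on $AB$. Let $r_1$ be the radius of the excircle of $\triangle ABD$ that touches side $BD$, $r_2$ the radius of the excircle of $\triangle ACD$ that touches side $DC$, $r_3$ the radius of the excircle of $\triangle BCE$ that touches side $CE$, $r_4$ the radius of the excircle of $\triangle BAE$ that touches side $EA$, $r_5$ the radius of the excircle of $\triangle CAF$ that touches side $AF$, and $r_6$ the radius of the excircle of $\triangle CBF$ that touches side $FB$. Then $$\frac{1}{r_1}+\frac{1}{r_3}+\frac{1}{r_5}=\frac{1}{r_2}+\frac{1}{r_4}+\frac{1}{r_6}.$$
   Context: The excircle of a triangle that touches a given side is the circle tangent to that side (segment) and to the extensions of the other two sides, lying on the opposite side of that segment from the remaining vertex. *)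

theory Defs
  imports "HOL-Analysis.Analysis"
begin

text \<open>In the plane, a line is tangent to a circle (of positive radius) iff it meets the circle
  in exactly one point.\<close>

definition tangent_at :: "(real^2) set \<Rightarrow> real^2 \<Rightarrow> real^2 \<Rightarrow> real^2 \<Rightarrow> bool" where
  "tangent_at \<omega> P Q T \<longleftrightarrow> \<omega> \<inter> affine hull {P, Q} = {T}"

text \<open>The circle with centre \<open>J\<close> and radius \<open>r\<close> is the excircle of the triangle \<open>V P Q\<close> that
  touches the side \<open>P Q\<close>; the first triangle argument is the remaining vertex. The extensions of
  a side are its line without the closed segment. In the last condition the circle lies in the
  closed half-plane (it touches the line \<open>P Q\<close>) opposite to \<open>V\<close>: every segment from \<open>V\<close> to
  a point of the circle meets that line.\<close>

definition is_excircle :: "real^2 \<Rightarrow> real \<Rightarrow> real^2 \<Rightarrow> real^2 \<Rightarrow> real^2 \<Rightarrow> bool" where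
  "is_excircle J r V P Q \<longleftrightarrow>
     r > 0 \<and>
     (\<exists>T \<in> closed_segment P Q. tangent_at (sphere J r) P Q T) \<and>
     (\<exists>T \<in> affine hull {V, P} - closed_segment V P. tangent_at (sphere J r) V P T) \<and>
     (\<exists>T \<in> affine hull {V, Q} - closed_segment V Q. tangent_at (sphere J r) V Q T) \<and>
     (\<forall>X \<in> sphere J r. closed_segment V X \<inter> affine hull {P, Q} \<noteq> {})"

definition is_exradius :: "real \<Rightarrow> real^2 \<Rightarrow> real^2 \<Rightarrow> real^2 \<Rightarrow> bool" where
  "is_exradius r V P Q \<longleftrightarrow> (\<exists>J. is_excircle J r V P Q)"

end

theory Submission
  imports Defs
begin

text \<open>
  Let \<open>t\<close> be the common length of the tangents from \<open>V\<close> to the excircle touching \<open>PQ\<close>. Equality of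
  the tangents from \<open>V\<close>, \<open>P\<close> and \<open>Q\<close> shows that \<open>t\<close> is the semiperimeter, and
  \<open>r sin \<theta> = t (1 - cos \<theta>)\<close> for the angle \<open>\<theta>\<close> at \<open>V\<close>. With the cosine rule this becomes
  \<open>1 / r = (VP + VQ - PQ) / (2 S)\<close>, where \<open>S\<close> is the area of \<open>V P Q\<close>. A median halves the area, so
  all six triangles have the same \<open>S\<close>; in the three differences \<open>1/r\<^sub>1 - 1/r\<^sub>2\<close>,
  \<open>1/r\<^sub>3 - 1/r\<^sub>4\<close>, \<open>1/r\<^sub>5 - 1/r\<^sub>6\<close> the medians and half sides cancel, leaving multiples of
  \<open>AB - AC\<close>, \<open>BC - BA\<close>, \<open>CA - CB\<close> by one factor, whose sum vanishes.
\<close>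

text \<open>The signed area of the parallelogram spanned by \<open>x\<close> and \<open>y\<close>;
  for two sides of a triangle its absolute value is twice the area.\<close>

definition cross2 :: "real^2 \<Rightarrow> real^2 \<Rightarrow> real" where
  "cross2 x y = x $ 1 * y $ 2 - x $ 2 * y $ 1"

lemma inner_real2: "x \<bullet> y = x $ 1 * y $ 1 + x $ 2 * y $ 2" for x y :: "real^2"
  by (simp add: inner_vec_def sum_2)

lemma inner_cross2_Lagrange: "(x \<bullet> y)\<^sup>2 + (cross2 x y)\<^sup>2 = (x \<bullet> x) * (y \<bullet> y)"
  unfolding inner_real2 cross2_def by algebra

lemma cross2_scaleR [simp]:
  "cross2 (k *\<^sub>R x) y = k * cross2 x y" "cross2 x (k *\<^sub>R y) = k * cross2 x y"
  by (simp_all add: cross2_def algebra_simps)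

lemma cross2_self [simp]: "cross2 x x = 0"
  by (simp add: cross2_def)

text \<open>Collinearity is the equality case of Cauchy-Schwarz, and by Lagrange's identity the
  defect in that inequality is the square of \<open>cross2\<close>.\<close>

lemma collinear_iff_cross2: "collinear {V, P, Q} \<longleftrightarrow> cross2 (P - V) (Q - V) = 0"
proof -
  have "collinear {V, P, Q} \<longleftrightarrow> collinear {0, P - V, Q - V}"
    by (simp add: insert_commute[of V P] collinear_3)
  also have "\<dots> \<longleftrightarrow> \<bar>(P - V) \<bullet> (Q - V)\<bar> = \<bar>norm (P - V) * norm (Q - V)\<bar>"
    by (simp add: norm_cauchy_schwarz_equal[symmetric])
  also have "\<dots> \<longleftrightarrow> ((P - V) \<bullet> (Q - V))\<^sup>2 = (norm (P - V) * norm (Q - V))\<^sup>2"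
    by (simp only: power2_eq_iff abs_eq_iff)
  also have "\<dots> \<longleftrightarrow> (cross2 (P - V) (Q - V))\<^sup>2 = 0"
    using inner_cross2_Lagrange[of "P - V" "Q - V"]
    by (simp only: power_mult_distrib power2_norm_eq_inner) linarith
  finally show ?thesis by simp
qed

lemma mem_affine_hull_2_iff:
  fixes P Q X :: "'a::real_vector"
  shows "X \<in> affine hull {P, Q} \<longleftrightarrow> (\<exists>k. X = P + k *\<^sub>R (Q - P))"
  unfolding affine_hull_2_alt by auto

lemma affine_hull_2_inter:
  assumes "cross2 (P - V) (Q - V) \<noteq> 0" "X \<in> affine hull {V, P}" "X \<in> affine hull {P, Q}"
  shows "X = P"
proof -
  obtain a b where X: "X = V + a *\<^sub>R (P - V)" "X = P + b *\<^sub>R (Q - P)"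
    using assms(2,3) by (metis mem_affine_hull_2_iff)
  \<comment> \<open>Taking \<open>cross2\<close> of \<open>P - V\<close> with \<open>X - P\<close>
    isolates \<open>b\<close> on one side and gives zero on the other, since \<open>X - P\<close> is
    parallel to \<open>P - V\<close>.\<close>
  have "b * cross2 (P - V) (Q - V) = cross2 (P - V) (P + b *\<^sub>R (Q - P) - P)"
    by (simp add: cross2_def algebra_simps)
  also have "\<dots> = cross2 (P - V) ((a - 1) *\<^sub>R (P - V))"
  proof -
    have "V + a *\<^sub>R (P - V) - P = (a - 1) *\<^sub>R (P - V)" by (simp add: algebra_simps)
    then show ?thesis using X by metis
  qed
  finally show ?thesis using assms(1) X(2) by simp
qed

text \<open>Were \<open>T\<close> not the foot of the perpendicular from \<open>J\<close>, its
  mirror image would be a second common point of line and circle.\<close>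

lemma tangent_at_orthogonal:
  assumes "tangent_at (sphere J r) P Q T"
  shows "(J - T) \<bullet> (Q - P) = 0"
proof (cases "P = Q")
  case False
  define d where "d = Q - P"
  define k where "k = (J - T) \<bullet> d / (d \<bullet> d)"
  \<comment> \<open>the reflection of \<open>T\<close> in the foot of the perpendicular from \<open>J\<close>\<close>
  define T' where "T' = T + (2 * k) *\<^sub>R d"
  have dd: "d \<bullet> d \<noteq> 0" using False by (simp add: d_def)
  then have kd: "k * (d \<bullet> d) = (J - T) \<bullet> d" by (simp add: k_def)
  have T: "T \<in> sphere J r" "T \<in> affine hull {P, Q}"
    using assms by (auto simp: tangent_at_def)
  obtain a where "T = P + a *\<^sub>R d" using T(2) by (auto simp: mem_affine_hull_2_iff d_def)
  then have "T' = P + (a + 2 * k) *\<^sub>R (Q - P)"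
    by (simp add: T'_def d_def algebra_simps)
  then have "T' \<in> affine hull {P, Q}" by (auto simp: mem_affine_hull_2_iff)
  moreover have "(w - m *\<^sub>R d) \<bullet> (w - m *\<^sub>R d) = w \<bullet> w - m * (2 * (w \<bullet> d) - m * (d \<bullet> d))"
    for w m by (simp add: inner_diff_left inner_diff_right inner_commute algebra_simps)
  from this[of "J - T" "2 * k"] have "(J - T') \<bullet> (J - T') = (J - T) \<bullet> (J - T)"
    using kd by (simp add: T'_def diff_diff_eq)
  then have "T' \<in> sphere J r"
    using T(1) by (simp add: dist_norm norm_eq[symmetric])
  ultimately have "T' = T" using assms unfolding tangent_at_def by blast
  then have "k = 0" using dd by (auto simp: T'_def)
  then show ?thesis using kd by (simp add: d_def)
qed simp

text \<open>Pythagoras in the right triangle \<open>X T J\<close>. The tangent length thus depends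
  only on \<open>X\<close> and the circle, not on the tangent line chosen.\<close>

lemma tangent_at_power:
  assumes "tangent_at (sphere J r) P Q T" "X \<in> affine hull {P, Q}"
  shows "(dist X J)\<^sup>2 = (dist X T)\<^sup>2 + r\<^sup>2"
proof -
  have T: "dist J T = r" "T \<in> affine hull {P, Q}"
    using assms(1) by (auto simp: tangent_at_def)
  obtain a b where "T = P + a *\<^sub>R (Q - P)" "X = P + b *\<^sub>R (Q - P)"
    using T(2) assms(2) by (auto simp: mem_affine_hull_2_iff)
  then have "X - T = (b - a) *\<^sub>R (Q - P)" by (simp add: scaleR_left_diff_distrib)
  then have orth: "(J - T) \<bullet> (X - T) = 0"
    using tangent_at_orthogonal[OF assms(1)] by simp
  have "(dist X J)\<^sup>2 = (norm ((X - T) - (J - T)))\<^sup>2" by (simp add: dist_norm)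
  also have "\<dots> = (norm (X - T))\<^sup>2 + (norm (J - T))\<^sup>2"
    using orth by (simp add: power2_norm_eq_inner inner_diff_left inner_diff_right inner_commute)
  finally show ?thesis using T(1) by (simp add: dist_norm)
qed

lemma tangent_lengths_eq:
  assumes "tangent_at (sphere J r) P Q T" "X \<in> affine hull {P, Q}"
    and "tangent_at (sphere J r) P' Q' T'" "X \<in> affine hull {P', Q'}"
  shows "dist X T = dist X T'"
  using tangent_at_power[OF assms(1,2)] tangent_at_power[OF assms(3,4)]
  by simp

text \<open>The segment \<open>V T\<close> stays on the line \<open>V P\<close>, which meets the
  line \<open>P Q\<close> only in \<open>P\<close>. This is how the half-plane condition on an
  excircle locates its tangent points.\<close>

lemma tangent_point_beyond:
  assumes "cross2 (P - V) (Q - V) \<noteq> 0" "T \<in> affine hull {V, P}"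
    and "closed_segment V T \<inter> affine hull {P, Q} \<noteq> {}"
  shows "P \<in> closed_segment V T"
proof -
  obtain X where X: "X \<in> closed_segment V T" "X \<in> affine hull {P, Q}" using assms(3) by auto
  have "closed_segment V T \<subseteq> affine hull {V, P}"
    unfolding segment_convex_hull
    by (rule hull_minimal) (use assms(2) in \<open>auto simp: hull_inc affine_imp_convex\<close>)
  with X affine_hull_2_inter[OF assms(1)] show ?thesis by blast
qed

text \<open>The point \<open>J\<close> projects orthogonally to \<open>T\<close> on the line
  \<open>V P\<close>, and \<open>T\<close> lies on the same side of \<open>V\<close> as
  \<open>P\<close>, so the projection has positive sign.\<close>

lemma tangent_ray:
  assumes tan: "tangent_at (sphere J r) V P T" and "P \<in> closed_segment V T" "V \<noteq> P"
  shows "(J - V) \<bullet> sgn (P - V) = dist V T"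
proof -
  obtain l where l: "P = (1 - l) *\<^sub>R V + l *\<^sub>R T" "0 \<le> l" using assms(2) by (auto simp: in_segment)
  have PV: "P - V = l *\<^sub>R (T - V)" using l(1) by (simp add: algebra_simps)
  with assms(3) l(2) have "l > 0" by (cases "l = 0") auto
  then have u: "sgn (P - V) = sgn (T - V)" by (simp add: PV sgn_scaleR)
  have "(J - T) \<bullet> (P - V) = 0" by (rule tangent_at_orthogonal[OF tan])
  then have "(J - T) \<bullet> sgn (P - V) = 0" by (simp add: sgn_div_norm)
  then have "(J - V) \<bullet> sgn (P - V) = (T - V) \<bullet> sgn (T - V)"
    by (simp add: u inner_diff_left)
  also have "\<dots> = dist V T"
    by (simp add: sgn_div_norm dist_norm norm_minus_commute divide_simps
        power2_norm_eq_inner[symmetric] power2_eq_square)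
  finally show ?thesis .
qed

lemma exradius_formula:
  assumes "is_exradius r V P Q" and nz: "cross2 (P - V) (Q - V) \<noteq> 0"
  shows "1 / r = (dist V P + dist V Q - dist P Q) / \<bar>cross2 (P - V) (Q - V)\<bar>"
proof -
  obtain J T T1 T2 where r: "r > 0"
    and T: "T \<in> closed_segment P Q" "tangent_at (sphere J r) P Q T"
    and T1: "tangent_at (sphere J r) V P T1"
    and T2: "tangent_at (sphere J r) V Q T2"
    and opp: "\<And>X. X \<in> sphere J r \<Longrightarrow> closed_segment V X \<inter> affine hull {P, Q} \<noteq> {}"
    using assms(1) unfolding is_exradius_def is_excircle_def by blast
  have nz': "cross2 (Q - V) (P - V) \<noteq> 0" using nz by (simp add: cross2_def algebra_simps)
  have ne: "V \<noteq> P" "V \<noteq> Q" using nz by (auto simp: cross2_def)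
  have mem: "T1 \<in> sphere J r" "T2 \<in> sphere J r" "T1 \<in> affine hull {V, P}" "T2 \<in> affine hull {V, Q}"
    using T1 T2 by (auto simp: tangent_at_def)
  have P: "P \<in> closed_segment V T1"
    by (rule tangent_point_beyond[OF nz mem(3) opp[OF mem(1)]])
  have Q: "Q \<in> closed_segment V T2"
    by (rule tangent_point_beyond[OF nz' mem(4)]) (use opp[OF mem(2)] in \<open>simp add: insert_commute\<close>)
  define t where "t = dist V T1"
  have t2: "t = dist V T2"
    unfolding t_def by (rule tangent_lengths_eq[OF T1 _ T2]) (auto simp: hull_inc)
  have PT: "dist P T1 = dist P T"
    by (rule tangent_lengths_eq[OF T1 _ T(2)]) (auto simp: hull_inc)
  have QT: "dist Q T2 = dist Q T"
    by (rule tangent_lengths_eq[OF T2 _ T(2)]) (auto simp: hull_inc)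
  \<comment> \<open>Betweenness turns the equal tangents into sums of lengths, which fixes
    \<open>t\<close> as the semiperimeter.\<close>
  have "dist V T1 = dist V P + dist P T1" "dist V T2 = dist V Q + dist Q T2"
    "dist P Q = dist P T + dist T Q"
    using P Q T(1) by (auto simp: between_mem_segment[symmetric] between)
  then have semi: "2 * t = dist V P + dist V Q + dist P Q"
    using t_def t2 PT QT by (simp add: dist_commute)
  define p q a where "p = dist V P" "q = dist V Q" "a = dist P Q"
  note pqa = this
  have pq: "p > 0" "q > 0" using ne by (auto simp: pqa)
  define u v where "u = sgn (P - V)" "v = sgn (Q - V)"
  note uv = this
  \<comment> \<open>The cosine and the signed sine of the angle at \<open>V\<close>.\<close>
  define c s where "c = u \<bullet> v" "s = cross2 u v"
  note cs = this
  have pu: "P - V = p *\<^sub>R u" and qv: "Q - V = q *\<^sub>R v"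
    using ne by (simp_all add: pqa uv sgn_div_norm dist_norm norm_minus_commute)
  have unit: "u \<bullet> u = 1" "v \<bullet> v = 1"
    using ne by (simp_all add: uv power2_norm_eq_inner[symmetric] norm_sgn)
  have c2: "c\<^sup>2 + s\<^sup>2 = 1" using inner_cross2_Lagrange[of u v] unit by (simp add: cs)
  have cr: "cross2 (P - V) (Q - V) = p * q * s" by (simp add: pu qv cs)
  then have s: "s \<noteq> 0" using nz by auto
  have "a\<^sup>2 = (P - V - (Q - V)) \<bullet> (P - V - (Q - V))"
    by (simp add: pqa dist_norm power2_norm_eq_inner)
  also have "\<dots> = p\<^sup>2 + q\<^sup>2 - 2 * p * q * c"
    unfolding pu qv cs(1) using unit
    by (simp add: inner_diff_left inner_diff_right inner_commute power2_eq_square)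
  finally have cosine: "a\<^sup>2 = p\<^sup>2 + q\<^sup>2 - 2 * p * q * c" .
  define j where "j = J - V"
  have ju: "j \<bullet> u = t" unfolding j_def uv(1) t_def by (rule tangent_ray[OF T1 P ne(1)])
  have jv: "j \<bullet> v = t" unfolding j_def uv(2) t2 by (rule tangent_ray[OF T2 Q ne(2)])
  have jj: "j \<bullet> j = t\<^sup>2 + r\<^sup>2"
    using tangent_at_power[OF T1, of V]
    by (simp add: hull_inc j_def t_def dist_norm norm_minus_commute power2_norm_eq_inner)
  \<comment> \<open>The distance from \<open>J\<close> to the line \<open>V P\<close> is
    \<open>r\<close>, so \<open>cross2 u j\<close> is \<open>r\<close> up to a sign given by the
    orientation.\<close>
  have rj: "(cross2 u j)\<^sup>2 = r\<^sup>2"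
    using inner_cross2_Lagrange[of u j] unit ju jj by (simp add: inner_commute)
  \<comment> \<open>This expands \<open>j \<bullet> v\<close> in the orthogonal frame of
    \<open>u\<close> and its quarter turn.\<close>
  have "(u \<bullet> u) * (j \<bullet> v) = (j \<bullet> u) * (u \<bullet> v) + cross2 u j * cross2 u v"
    unfolding inner_real2 cross2_def by algebra
  then have "t * (1 - c) = cross2 u j * s" using unit ju jv by (simp add: cs algebra_simps)
  \<comment> \<open>Squaring removes the unknown sign; both bases are nonnegative, so the square
    root can be taken afterwards.\<close>
  then have "(t * (1 - c))\<^sup>2 = (r * \<bar>s\<bar>)\<^sup>2" using rj by (simp add: power_mult_distrib)
  moreover have "c \<le> 1" using c2 by (metis abs_le_D1 abs_square_le_1 le_add_same_cancel1 zero_le_power2)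
  moreover have "t \<ge> 0" by (simp add: t_def)
  ultimately have tan_half: "t * (1 - c) = r * \<bar>s\<bar>"
    using r by simp
  \<comment> \<open>With \<open>2 * t = p + q + a\<close> the product is a difference of squares,
    which the cosine rule turns into \<open>2 * p * q * (1 + c)\<close>.\<close>
  have "2 * (r * \<bar>s\<bar>) * (p + q - a) = (2 * t) * (p + q - a) * (1 - c)"
    by (simp add: tan_half[symmetric])
  also have "\<dots> = ((p + q)\<^sup>2 - a\<^sup>2) * (1 - c)"
    unfolding semi pqa[symmetric] by (simp add: power2_eq_square algebra_simps)
  also have "\<dots> = 2 * (p * q) * (1 - c\<^sup>2)"
    unfolding cosine by (simp add: power2_eq_square algebra_simps)
  also have "\<dots> = 2 * (p * q * \<bar>s\<bar>) * \<bar>s\<bar>"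
    using c2 by (simp add: power2_eq_square[symmetric])
  finally have "(r * (p + q - a)) * \<bar>s\<bar> = (p * q * \<bar>s\<bar>) * \<bar>s\<bar>"
    by algebra
  then have "r * (p + q - a) = p * q * \<bar>s\<bar>"
    using s by (simp only: mult_cancel_right abs_eq_0 simp_thms)
  then show ?thesis
    using r s pq unfolding cr pqa[symmetric] by (simp add: abs_mult field_simps)
qed

text \<open>The two halves have the same cross product, half that of \<open>V P Q\<close>; this
  halving is the source of the factor 2.\<close>

lemma exradius_median_diff:
  assumes "\<not> collinear {V, P, Q}"
    and "is_exradius r V P (midpoint P Q)" "is_exradius r' V (midpoint P Q) Q"
  shows "1 / r - 1 / r' = 2 * (dist V P - dist V Q) / \<bar>cross2 (P - V) (Q - V)\<bar>"
proof -
  define S where "S = cross2 (P - V) (Q - V)"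
  let ?D = "midpoint P Q"
  have S: "S \<noteq> 0" using assms(1) by (simp add: collinear_iff_cross2 S_def)
  have half: "cross2 (P - V) (?D - V) = S / 2" "cross2 (?D - V) (Q - V) = S / 2"
    by (simp_all add: cross2_def S_def midpoint_def field_simps)
  have d: "dist P ?D = dist P Q / 2" "dist ?D Q = dist P Q / 2"
    by (simp_all add: dist_midpoint)
  have "1 / r - 1 / r' = (dist V P + dist V ?D - dist P ?D) / \<bar>S / 2\<bar>
      - (dist V ?D + dist V Q - dist ?D Q) / \<bar>S / 2\<bar>"
    using exradius_formula[OF assms(2)] exradius_formula[OF assms(3)] S by (simp add: half)
  also have "\<dots> = (dist V P - dist V Q) / \<bar>S / 2\<bar>"
    by (simp only: d diff_divide_distrib[symmetric]) simp
  finally show ?thesis by (simp add: S_def ac_simps)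
qed

theorem theorem3p1:
  fixes A B C D E F M :: "real^2" and r1 r2 r3 r4 r5 r6 :: real
  assumes "\<not> collinear {A, B, C}"
    and "M = (1/3) *\<^sub>R (A + B + C)"
    and "D = midpoint B C" and "E = midpoint C A" and "F = midpoint A B"
    and "is_exradius r1 A B D"
    and "is_exradius r2 A D C"
    and "is_exradius r3 B C E"
    and "is_exradius r4 B E A"
    and "is_exradius r5 C A F"
    and "is_exradius r6 C F B"
  shows "1 / r1 + 1 / r3 + 1 / r5 = 1 / r2 + 1 / r4 + 1 / r6"
proof -
  define S where "S = \<bar>cross2 (B - A) (C - A)\<bar>"
  \<comment> \<open>Twice the area of \<open>A B C\<close> is the same computed from any vertex, so
    the three differences share one denominator.\<close>
  have S: "\<bar>cross2 (C - B) (A - B)\<bar> = S" "\<bar>cross2 (A - C) (B - C)\<bar> = S"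
    by (simp_all add: S_def cross2_def algebra_simps)
  have nc: "\<not> collinear {B, C, A}" "\<not> collinear {C, A, B}"
    using assms(1) by (simp_all add: insert_commute)
  have "1 / r1 - 1 / r2 = 2 * (dist A B - dist A C) / S"
    unfolding S_def by (rule exradius_median_diff) (use assms in auto)
  moreover have "1 / r3 - 1 / r4 = 2 * (dist B C - dist B A) / S"
    unfolding S(1)[symmetric] by (rule exradius_median_diff) (use assms nc in auto)
  moreover have "1 / r5 - 1 / r6 = 2 * (dist C A - dist C B) / S"
    unfolding S(2)[symmetric] by (rule exradius_median_diff) (use assms nc in auto)
  ultimately have "(1 / r1 - 1 / r2) + (1 / r3 - 1 / r4) + (1 / r5 - 1 / r6) = 0"
    by (simp add: dist_commute add_divide_distrib[symmetric])
  then show ?thesis by linarith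
qed

end
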